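(* Every automata cascade $C$ that is an automaton on assignments admits an equivalent program $P$: the input variables of $C$ are input variables of $P$, its output variables are variables of $P$, and for every input string (interpretation) $I$, every time point $t$ and every output variable $a$ of $C$, $(C,I,t)\vdash a$ if and only if $(P,I,t)\models a$.
   Context: Write $\mathbb{B}=\{0,1\}$. Static formulas are built from propositional variables and the constants $\top,\bot$ using $\neg,\land,\lor$. An operator automaton is a tuple $\mathcal{A}=\langle \mathbb{B}^m,[1,n],\delta,q_{\mathrm{init}}\rangle$ with $\delta:[1,n]\times\mathbb{B}^m\to[1,n]$ and $q_{\mathrm{init}}\in[1,n]$. A static rule is $p \;{:}{-}\; \alpha$ ($p$ a variable, $\alpha$ a static formula); a delay rule is $p \;{:}{-}\; \ominus q$; a dynamic rule is $p_1,\dots,p_n \;{:}{-}\; \mathcal{A}(a_1,\dots,a_m)$ with $\mathcal{A}$ an operator automaton of input arity $m$ and output arity $n$. A program is a finite set of rules that is nonrecursive (the graph with an edge from $a$ to $b$ whenever $a$ occurs in the body and $b$ in the head of some rule is acyclic) and definitorial (each variable occurs in a head at most once). Variables defined by no rule are input variables. An interpretation is a finite non-empty sequence $I=I_1,\dots,I_\ell$ of subsets of the input variables. Satisfaction $(P,I,t)\models\cdot$: $\top$ holds, $\bot$ does not; an input variable $a$ holds iff $a\in I_t$; $\neg,\land,\lor$ as usual; $p$ defined by $p\;{:}{-}\;\alpha$ holds iff $(P,I,t)\models\alpha$; $p$ defined by $p\;{:}{-}\;\ominus q$ holds iff $(P,I,t-1)\models q$; for $p_i$ defined by the dynamic rule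 above, $(P,I,0)\models p_i$ iff $q_{\mathrm{init}}=i$, and for $t>0$, $(P,I,t)\models p_i$ iff there are $j$ and an assignment $\sigma\in\mathbb{B}^m$ to $(a_1,\dots,a_m)$ with $\delta(j,\sigma)=i$, $(P,I,t-1)\models p_j$ and $(P,I,t)\models\sigma$ (assignment identified with the conjunction of literals it makes true). An automaton is $A=\langle\Sigma,Q,\delta,q_{\mathrm{init}},\Gamma,\theta\rangle$ with $\delta:Q\times\Sigma\to Q$, $\theta:Q\times\Sigma\to\Gamma$; on input $\sigma_1\dots\sigma_\ell$ its states are $q_0=q_{\mathrm{init}}$, $q_i=\delta(q_{i-1},\sigma_i)$ and upon reading $\sigma_i$ it outputs $\theta(q_{i-1},\sigma_i)$. An automaton on assignments has $\Sigma=\mathbb{B}^m$, $\Gamma=\mathbb{B}^k$, read as assignments to ordered input variables and ordered output variables $b_1,\dots,b_k$; a string over $\mathbb{B}^m$ is identified with an interpretation, and $(A,I,t)\vdash b_i$ means the output upon reading the $t$-th letter assigns $1$ to $b_i$. An automata cascade $A_1\ltimes\dots\ltimes A_d$ of automata $A_i=\langle\Sigma_i,Q_i,\delta_i,q^{\mathrm{init}}_i,\Gamma_i,\theta_i\rangle$ with $\Sigma_i=\Sigma\times\Gamma_1\times\dots\times\Gamma_{i-1}$ is the automaton with input alphabet $\Sigma$, states $Q_1\times\dots\times Q_d$, initial state $\langle q^{\mathrm{init}}_1,\dots,q^{\mathrm{init}}_d\rangle$, transition $\delta(\langle q_1,\dots,q_d\rangle,\sigma)=\langle\delta_1(q_1,\sigma_1),\dots,\delta_d(q_d,\sigma_d)\rangle$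 where $\sigma_i=\langle\sigma,\theta_1(q_1,\sigma_1),\dots,\theta_{i-1}(q_{i-1},\sigma_{i-1})\rangle$, and output $\theta_d(q_d,\sigma_d)\in\Gamma_d$.
   Formalization: The automata are taken to be finite (finite alphabet, state set and output alphabet), and the input and output variables of C are taken to be pairwise distinct with no variable both input and output; without these the claim fails. *)

theory Defs
  imports Main "HOL-Library.Infinite_Typeclass"
begin

section \<open>Programs\<close>

datatype (vars_form: 'v) form =
  Top | Bot | Var 'v | Neg "'v form" | And "'v form" "'v form" | Or "'v form" "'v form"

text \<open>Operator automata have input letters in \<open>\<bool>\<^sup>m\<close>, rendered as Boolean lists of length \<open>m\<close>,
  and states \<open>1, \<dots>, n\<close>. The state \<open>i\<close> corresponds to the \<open>i\<close>-th head variable of a dynamic rule,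
  which sits at list position \<open>i - 1\<close>.\<close>

datatype op_automaton = Op_Automaton
  (in_arity: nat) (out_arity: nat) (op_step: "nat \<Rightarrow> bool list \<Rightarrow> nat") (op_start: nat)

definition wf_op_automaton :: "op_automaton \<Rightarrow> bool" where
  "wf_op_automaton A \<longleftrightarrow>
     op_start A \<in> {1..out_arity A} \<and>
     (\<forall>j \<in> {1..out_arity A}. \<forall>\<sigma>. length \<sigma> = in_arity A \<longrightarrow> op_step A j \<sigma> \<in> {1..out_arity A})"

datatype 'v rule =
  Static 'v "'v form"
| Delay 'v 'v
| Dynamic "'v list" op_automaton "'v list"

primrec head_vars :: "'v rule \<Rightarrow> 'v list" where
  "head_vars (Static p \<alpha>) = [p]"
| "head_vars (Delay p q) = [p]"
| "head_vars (Dynamic ps A as) = ps"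

primrec body_vars :: "'v rule \<Rightarrow> 'v set" where
  "body_vars (Static p \<alpha>) = vars_form \<alpha>"
| "body_vars (Delay p q) = {q}"
| "body_vars (Dynamic ps A as) = set as"

primrec wf_rule :: "'v rule \<Rightarrow> bool" where
  "wf_rule (Static p \<alpha>) \<longleftrightarrow> True"
| "wf_rule (Delay p q) \<longleftrightarrow> True"
| "wf_rule (Dynamic ps A as) \<longleftrightarrow>
     wf_op_automaton A \<and> length ps = out_arity A \<and> length as = in_arity A"

definition dep :: "'v rule set \<Rightarrow> ('v \<times> 'v) set" where
  "dep P = {(a, b). \<exists>r \<in> P. a \<in> body_vars r \<and> b \<in> set (head_vars r)}"

definition nonrecursive :: "'v rule set \<Rightarrow> bool" where
  "nonrecursive P \<longleftrightarrow> acyclic (dep P)"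

definition definitorial :: "'v rule set \<Rightarrow> bool" where
  "definitorial P \<longleftrightarrow>
     (\<forall>r \<in> P. distinct (head_vars r)) \<and>
     (\<forall>r \<in> P. \<forall>s \<in> P. r \<noteq> s \<longrightarrow> set (head_vars r) \<inter> set (head_vars s) = {})"

definition program :: "'v rule set \<Rightarrow> bool" where
  "program P \<longleftrightarrow> finite P \<and> (\<forall>r \<in> P. wf_rule r) \<and> nonrecursive P \<and> definitorial P"

definition defined_vars :: "'v rule set \<Rightarrow> 'v set" where
  "defined_vars P = (\<Union>r \<in> P. set (head_vars r))"

definition program_vars :: "'v rule set \<Rightarrow> 'v set" where
  "program_vars P = (\<Union>r \<in> P. set (head_vars r) \<union> body_vars r)"

definition input_vars :: "'v rule set \<Rightarrow> 'v set" where
  "input_vars P = program_vars P - defined_vars P"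

definition interp_over :: "'v set \<Rightarrow> 'v set list \<Rightarrow> bool" where
  "interp_over V I \<longleftrightarrow> I \<noteq> [] \<and> (\<forall>X \<in> set I. X \<subseteq> V)"

primrec literal :: "'v \<Rightarrow> bool \<Rightarrow> 'v form" where
  "literal a True = Var a"
| "literal a False = Neg (Var a)"

definition assignment_form :: "'v list \<Rightarrow> bool list \<Rightarrow> 'v form" where
  "assignment_form as \<sigma> = foldr And (map2 literal as \<sigma>) Top"

subsection \<open>A termination order for satisfaction\<close>

definition dep_rank :: "'v rule set \<Rightarrow> 'v \<Rightarrow> nat" where
  "dep_rank P p = card {a. (a, p) \<in> (dep P)\<^sup>+}"

definition form_rank :: "'v rule set \<Rightarrow> 'v form \<Rightarrow> nat" where
  "form_rank P \<alpha> = Max (insert 0 ((\<lambda>p. Suc (dep_rank P p)) ` vars_form \<alpha>))"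

lemma finite_vars_form [simp]: "finite (vars_form \<alpha>)"
  by (induction \<alpha>) auto

lemma finite_body_vars [simp]: "finite (body_vars r)"
  by (cases r) auto

lemma finite_dep:
  assumes "finite P"
  shows "finite (dep P)"
proof (rule finite_subset)
  show "dep P \<subseteq> (\<Union>r \<in> P. body_vars r \<times> set (head_vars r))"
    by (auto simp: dep_def)
  show "finite (\<Union>r \<in> P. body_vars r \<times> set (head_vars r))"
    using assms by auto
qed

lemma dep_rank_less:
  assumes "program P" and "(a, b) \<in> dep P"
  shows "dep_rank P a < dep_rank P b"
  unfolding dep_rank_def
proof (rule psubset_card_mono)
  have "finite ((dep P)\<^sup>+)"
    using assms(1) by (simp add: program_def finite_dep)
  then have "finite (fst ` (dep P)\<^sup>+)"
    by simp
  then show "finite {x. (x, b) \<in> (dep P)\<^sup>+}"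
    by (rule rev_finite_subset) force
  have "(a, a) \<notin> (dep P)\<^sup>+"
    using assms(1) by (simp add: program_def nonrecursive_def acyclic_def)
  then show "{x. (x, a) \<in> (dep P)\<^sup>+} \<subset> {x. (x, b) \<in> (dep P)\<^sup>+}"
    using assms(2) by (auto intro: trancl_into_trancl)
qed

lemma form_rank_mono: "vars_form \<alpha> \<subseteq> vars_form \<beta> \<Longrightarrow> form_rank P \<alpha> \<le> form_rank P \<beta>"
  unfolding form_rank_def by (rule Max_mono) auto

lemma form_rank_less:
  assumes "program P" and "r \<in> P" and "p \<in> set (head_vars r)" and "vars_form \<alpha> \<subseteq> body_vars r"
  shows "form_rank P \<alpha> < form_rank P (Var p)"
proof -
  have "dep_rank P a < dep_rank P p" if "a \<in> vars_form \<alpha>" for a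
    using assms that by (intro dep_rank_less) (auto simp: dep_def)
  then show ?thesis
    by (auto simp: form_rank_def)
qed

lemma vars_literal [simp]: "vars_form (literal a b) = {a}"
  by (cases b) auto

lemma vars_assignment_form: "vars_form (assignment_form as \<sigma>) \<subseteq> set as"
  unfolding assignment_form_def by (induction as \<sigma> rule: list_induct2') auto

subsection \<open>Satisfaction\<close>

text \<open>The letter at time point \<open>t \<ge> 1\<close> is \<open>I ! (t - 1)\<close>. Time point 0 precedes the first letter:
  there input variables and variables defined by a delay rule are false. The conjunct
  \<open>program P\<close> only serves to make the recursion terminate.\<close>

context
  notes conj_cong [fundef_cong]
begin

function sat :: "'v rule set \<Rightarrow> 'v set list \<Rightarrow> nat \<Rightarrow> 'v form \<Rightarrow> bool" where
  "sat P I t Top \<longleftrightarrow> True"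
| "sat P I t Bot \<longleftrightarrow> False"
| "sat P I t (Neg \<alpha>) \<longleftrightarrow> \<not> sat P I t \<alpha>"
| "sat P I t (And \<alpha> \<beta>) \<longleftrightarrow> sat P I t \<alpha> \<and> sat P I t \<beta>"
| "sat P I t (Or \<alpha> \<beta>) \<longleftrightarrow> sat P I t \<alpha> \<or> sat P I t \<beta>"
| "sat P I t (Var p) \<longleftrightarrow> program P \<and>
     ((p \<notin> defined_vars P \<and> t \<in> {1..length I} \<and> p \<in> I ! (t - 1)) \<or>
      (\<exists>\<alpha>. Static p \<alpha> \<in> P \<and> sat P I t \<alpha>) \<or>
      (\<exists>q. Delay p q \<in> P \<and> t > 0 \<and> sat P I (t - 1) (Var q)) \<or>
      (\<exists>ps A as i. Dynamic ps A as \<in> P \<and> i \<in> {1..length ps} \<and> p = ps ! (i - 1) \<and>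
         (if t = 0 then op_start A = i
          else \<exists>j \<sigma>. j \<in> {1..length ps} \<and> length \<sigma> = length as \<and> op_step A j \<sigma> = i \<and>
                 sat P I (t - 1) (Var (ps ! (j - 1))) \<and> sat P I t (assignment_form as \<sigma>))))"
  by pat_completeness auto

termination
proof (relation "inv_image (less_than <*lex*> less_than <*lex*> less_than)
    (\<lambda>(P, I, t, \<alpha>). (t, form_rank P \<alpha>, size \<alpha>))", goal_cases)
  case 1
  show ?case by auto
next
  case (2 P I t \<alpha>)
  have "form_rank P \<alpha> \<le> form_rank P (Neg \<alpha>)" by (rule form_rank_mono) auto
  then show ?case by auto
next
  case (3 P I t \<alpha> \<beta>)
  have "form_rank P \<alpha> \<le> form_rank P (And \<alpha> \<beta>)" by (rule form_rank_mono) auto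
  then show ?case by auto
next
  case (4 P I t \<alpha> \<beta>)
  have "form_rank P \<beta> \<le> form_rank P (And \<alpha> \<beta>)" by (rule form_rank_mono) auto
  then show ?case by auto
next
  case (5 P I t \<alpha> \<beta>)
  have "form_rank P \<alpha> \<le> form_rank P (Or \<alpha> \<beta>)" by (rule form_rank_mono) auto
  then show ?case by auto
next
  case (6 P I t \<alpha> \<beta>)
  have "form_rank P \<beta> \<le> form_rank P (Or \<alpha> \<beta>)" by (rule form_rank_mono) auto
  then show ?case by auto
next
  case (7 P I t p \<alpha>)
  then have "form_rank P \<alpha> < form_rank P (Var p)"
    by (intro form_rank_less[where r = "Static p \<alpha>"]) auto
  then show ?case by auto
next
  case (8 P I t p q)
  then show ?case by auto
next
  case (9 P I t p ps A as i j \<sigma>)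
  then show ?case by auto
next
  case (10 P I t p ps A as i j \<sigma>)
  then have "form_rank P (assignment_form as \<sigma>) < form_rank P (Var p)"
    using vars_assignment_form[of as \<sigma>]
    by (intro form_rank_less[where r = "Dynamic ps A as"]) auto
  then show ?case by auto
qed

end

section \<open>Automata and cascades\<close>

record ('s, 'q, 'g) automaton =
  letters :: "'s set"
  states :: "'q set"
  step :: "'q \<Rightarrow> 's \<Rightarrow> 'q"
  start :: "'q"
  outputs :: "'g set"
  emit :: "'q \<Rightarrow> 's \<Rightarrow> 'g"

definition wf_automaton :: "('s, 'q, 'g) automaton \<Rightarrow> bool" where
  "wf_automaton A \<longleftrightarrow>
     finite (letters A) \<and> finite (states A) \<and> finite (outputs A) \<and> start A \<in> states A \<and>
     (\<forall>q \<in> states A. \<forall>\<sigma> \<in> letters A. step A q \<sigma> \<in> states A \<and> emit A q \<sigma> \<in> outputs A)"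

definition state_after :: "('s, 'q, 'g) automaton \<Rightarrow> 's list \<Rightarrow> 'q" where
  "state_after A w = foldl (step A) (start A) w"

text \<open>The output upon reading the \<open>t\<close>-th letter, for \<open>1 \<le> t \<le> length w\<close>.\<close>

definition output_at :: "('s, 'q, 'g) automaton \<Rightarrow> 's list \<Rightarrow> nat \<Rightarrow> 'g" where
  "output_at A w t = emit A (state_after A (take (t - 1) w)) (w ! (t - 1))"

text \<open>A cascade \<open>A\<^sub>1 \<ltimes> \<dots> \<ltimes> A\<^sub>d\<close> (\<open>d \<ge> 1\<close>) is given by the list \<open>As = [A\<^sub>1, \<dots>, A\<^sub>d\<^sub>-\<^sub>1]\<close> and its last
  component \<open>B = A\<^sub>d\<close>, which is kept apart because its output type, being that of the
  cascade, may differ from that of the internal letters. The components share one type of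
  states and one type of internal letters, but each has its own state and output sets in them.
  The input letter \<open>\<langle>\<sigma>, \<gamma>\<^sub>1, \<dots>, \<gamma>\<^sub>i\<^sub>-\<^sub>1\<rangle>\<close> of the \<open>i\<close>-th component is \<open>(\<sigma>, [\<gamma>\<^sub>1, \<dots>, \<gamma>\<^sub>i\<^sub>-\<^sub>1])\<close>.\<close>

definition is_cascade ::
  "'s set \<Rightarrow> ('s \<times> 'g list, 'q, 'g) automaton list \<Rightarrow> ('s \<times> 'g list, 'q, 'o) automaton \<Rightarrow> bool"
where
  "is_cascade S As B \<longleftrightarrow>
     (\<forall>i < length As. wf_automaton (As ! i) \<and>
        letters (As ! i) = S \<times> listset (map outputs (take i As))) \<and>
     wf_automaton B \<and> letters B = S \<times> listset (map outputs As)"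

text \<open>\<open>prefix_outputs As qs \<sigma> i\<close> is \<open>[\<theta>\<^sub>1(q\<^sub>1, \<sigma>\<^sub>1), \<dots>, \<theta>\<^sub>i(q\<^sub>i, \<sigma>\<^sub>i)]\<close>.\<close>

primrec prefix_outputs ::
  "('s \<times> 'g list, 'q, 'g) automaton list \<Rightarrow> 'q list \<Rightarrow> 's \<Rightarrow> nat \<Rightarrow> 'g list"
where
  "prefix_outputs As qs \<sigma> 0 = []"
| "prefix_outputs As qs \<sigma> (Suc i) =
     prefix_outputs As qs \<sigma> i @ [emit (As ! i) (qs ! i) (\<sigma>, prefix_outputs As qs \<sigma> i)]"

definition cascade ::
  "'s set \<Rightarrow> ('s \<times> 'g list, 'q, 'g) automaton list \<Rightarrow> ('s \<times> 'g list, 'q, 'o) automaton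
     \<Rightarrow> ('s, 'q list, 'o) automaton"
where
  "cascade S As B =
     \<lparr>letters = S,
      states = listset (map states As @ [states B]),
      step = (\<lambda>qs \<sigma>.
        map (\<lambda>i. step (As ! i) (qs ! i) (\<sigma>, prefix_outputs As qs \<sigma> i)) [0..<length As] @
        [step B (qs ! length As) (\<sigma>, prefix_outputs As qs \<sigma> (length As))]),
      start = map start As @ [start B],
      outputs = outputs B,
      emit = (\<lambda>qs \<sigma>. emit B (qs ! length As) (\<sigma>, prefix_outputs As qs \<sigma> (length As)))\<rparr>"

lemma in_listset_iff:
  "xs \<in> listset Xs \<longleftrightarrow> length xs = length Xs \<and> (\<forall>i < length Xs. xs ! i \<in> Xs ! i)"
proof (induction Xs arbitrary: xs)
  case (Cons X Xs)
  then show ?case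
    by (cases xs) (auto simp: set_Cons_def nth_Cons split: nat.splits)
qed auto

lemma finite_listset: "(\<And>X. X \<in> set Xs \<Longrightarrow> finite X) \<Longrightarrow> finite (listset Xs)"
proof (induction Xs)
  case (Cons X Xs)
  have "listset (X # Xs) = (\<lambda>(x, xs). x # xs) ` (X \<times> listset Xs)"
    by (auto simp: set_Cons_def)
  then show ?case using Cons by simp
qed auto

lemma prefix_outputs_in_listset:
  assumes "is_cascade S As B" "\<sigma> \<in> S" "qs \<in> states (cascade S As B)" "i \<le> length As"
  shows "prefix_outputs As qs \<sigma> i \<in> listset (map outputs (take i As))"
  using assms(4)
proof (induction i)
  case (Suc i)
  let ?g = "prefix_outputs As qs \<sigma> i"
  have i: "i < length As" using Suc by simp
  have q: "qs ! i \<in> states (As ! i)"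
    using assms(3) i by (auto simp: cascade_def in_listset_iff nth_append dest!: spec[of _ i])
  have "(\<sigma>, ?g) \<in> letters (As ! i)"
    using assms(1,2) i Suc by (simp add: is_cascade_def)
  then have e: "emit (As ! i) (qs ! i) (\<sigma>, ?g) \<in> outputs (As ! i)"
    using assms(1) i q by (auto simp: is_cascade_def wf_automaton_def)
  show ?case
    using Suc e i by (auto simp: in_listset_iff nth_append less_Suc_eq)
qed auto

lemma wf_automaton_cascade:
  assumes c: "is_cascade S As B" and "finite S"
  shows "wf_automaton (cascade S As B)"
proof -
  let ?C = "cascade S As B"
  have wf: "wf_automaton (As ! i)" if "i < length As" for i
    using c that by (simp add: is_cascade_def)
  have wfB: "wf_automaton B" using c by (simp add: is_cascade_def)
  have "finite (states ?C)"
    unfolding cascade_def using wf wfB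
    by (auto intro!: finite_listset simp: in_set_conv_nth wf_automaton_def)
  moreover have "start ?C \<in> states ?C"
    using wf wfB by (auto simp: cascade_def in_listset_iff nth_append less_Suc_eq wf_automaton_def)
  moreover have "step ?C qs \<sigma> \<in> states ?C \<and> emit ?C qs \<sigma> \<in> outputs ?C"
    if q: "qs \<in> states ?C" and s: "\<sigma> \<in> S" for qs \<sigma>
  proof -
    have qi: "qs ! i \<in> states (As ! i)" if "i < length As" for i
      using q that by (auto simp: cascade_def in_listset_iff nth_append dest!: spec[of _ i])
    have qB: "qs ! length As \<in> states B"
      using q by (auto simp: cascade_def in_listset_iff nth_append dest!: spec[of _ "length As"])
    have l: "(\<sigma>, prefix_outputs As qs \<sigma> i) \<in> letters (As ! i)" if "i < length As" for i
      using c s that prefix_outputs_in_listset[OF c s q, of i] by (simp add: is_cascade_def)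
    have lB: "(\<sigma>, prefix_outputs As qs \<sigma> (length As)) \<in> letters B"
      using c s prefix_outputs_in_listset[OF c s q, of "length As"] by (simp add: is_cascade_def)
    have "step (As ! i) (qs ! i) (\<sigma>, prefix_outputs As qs \<sigma> i) \<in> states (As ! i)"
      if "i < length As" for i
      using wf[OF that] qi[OF that] l[OF that] by (simp add: wf_automaton_def)
    then show ?thesis
      using wfB qB lB
      by (auto simp: cascade_def in_listset_iff nth_append less_Suc_eq wf_automaton_def)
  qed
  ultimately show ?thesis
    using wfB \<open>finite S\<close> by (auto simp: wf_automaton_def cascade_def)
qed

section \<open>Automata on assignments\<close>

text \<open>\<open>ins\<close> and \<open>outs\<close> are the ordered input and output variables; they are pairwise
  distinct and no variable is both.\<close>

definition automaton_on_assignments ::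
  "(bool list, 'q, bool list) automaton \<Rightarrow> 'v list \<Rightarrow> 'v list \<Rightarrow> bool"
where
  "automaton_on_assignments A ins outs \<longleftrightarrow>
     wf_automaton A \<and> distinct (ins @ outs) \<and>
     letters A = {w. length w = length ins} \<and> outputs A = {w. length w = length outs}"

definition assignment_string :: "'v list \<Rightarrow> 'v set list \<Rightarrow> bool list list" where
  "assignment_string ins I = map (\<lambda>X. map (\<lambda>a. a \<in> X) ins) I"

definition derives ::
  "(bool list, 'q, bool list) automaton \<Rightarrow> 'v list \<Rightarrow> 'v list \<Rightarrow> 'v set list \<Rightarrow> nat \<Rightarrow> 'v \<Rightarrow> bool"
where
  "derives A ins outs I t b \<longleftrightarrow>
     (\<exists>i < length outs. outs ! i = b \<and> output_at A (assignment_string ins I) t ! i)"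

end

theory Submission
  imports Defs
begin

text \<open>A cascade is itself a single finite automaton on assignments, so one dynamic rule suffices:
  numbering the states of the cascade by \<open>1, \<dots>, n\<close> turns its transition function into an operator
  automaton whose head variable \<open>p\<^sub>i\<close> holds at time \<open>t\<close> iff the cascade is in state \<open>i\<close> after
  reading \<open>t\<close> letters. The output upon reading the \<open>t\<close>-th letter depends on the state \<^emph>\<open>before\<close> that
  letter, which is made available by delay rules \<open>d\<^sub>i :- \<ominus> p\<^sub>i\<close>. Each output variable is then a
  static disjunction over the pairs of a state and a letter for which its output bit is 1.\<close>

section \<open>Satisfaction of a variable read off from its defining rule\<close>

declare sat.simps(6) [simp del]

text \<open>Definitoriality in usable form: a head variable determines its rule, so only one of the
  four disjuncts in the equation for \<open>Var p\<close> can survive.\<close>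

lemma rule_unique:
  assumes "program P" "r \<in> P" "s \<in> P" "x \<in> set (head_vars r)" "x \<in> set (head_vars s)"
  shows "r = s"
  using assms unfolding program_def definitorial_def by blast

text \<open>Removes the dynamic disjunct as a whole; \<open>X\<close> stands for its temporal
  condition, which need not be inspected.\<close>

lemma no_Dynamic_head:
  assumes "\<And>ps A as. Dynamic ps A as \<in> P \<Longrightarrow> p \<notin> set ps"
  shows "\<nexists>ps A as i. Dynamic ps A as \<in> P \<and> i \<in> {1..length ps} \<and> p = ps ! (i - 1) \<and> X ps A as i"
proof -
  have "ps ! (i - 1) \<in> set ps" if "i \<in> {1..length ps}" for ps :: "'a list" and i
    using that by auto
  with assms show ?thesis
    by metis
qed

lemma sat_input:
  assumes "program P" "p \<notin> defined_vars P"
  shows "sat P I t (Var p) \<longleftrightarrow> t \<in> {1..length I} \<and> p \<in> I ! (t - 1)"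
proof -
  have "p \<notin> set (head_vars r)" if "r \<in> P" for r
    using assms(2) that by (auto simp: defined_vars_def)
  from this[of "Static p _"] this[of "Delay p _"] this[of "Dynamic _ _ _"]
  have "Static p \<alpha> \<notin> P" "Delay p q \<notin> P" "Dynamic ps A as \<in> P \<Longrightarrow> p \<notin> set ps" for \<alpha> q ps A as
    by auto
  then show ?thesis
    by (subst sat.simps(6)) (simp only: assms no_Dynamic_head simp_thms)
qed

lemma sat_Static:
  assumes "program P" "Static p \<alpha> \<in> P"
  shows "sat P I t (Var p) \<longleftrightarrow> sat P I t \<alpha>"
proof -
  have u: "r = Static p \<alpha>" if "r \<in> P" "p \<in> set (head_vars r)" for r
    using rule_unique[OF assms(1) that(1) assms(2) that(2)] by simp
  have "Static p \<beta> \<in> P \<longleftrightarrow> \<beta> = \<alpha>" "Delay p q \<notin> P" "Dynamic ps A as \<in> P \<Longrightarrow> p \<notin> set ps" for \<beta> q ps A as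
    using assms(2) u[of "Static p \<beta>"] u[of "Delay p q"] u[of "Dynamic ps A as"] by auto
  moreover have "p \<in> defined_vars P"
    using assms(2) by (force simp: defined_vars_def)
  ultimately show ?thesis
    by (subst sat.simps(6)) (simp only: assms no_Dynamic_head simp_thms)
qed

lemma sat_Delay:
  assumes "program P" "Delay p q \<in> P"
  shows "sat P I t (Var p) \<longleftrightarrow> t > 0 \<and> sat P I (t - 1) (Var q)"
proof -
  have u: "r = Delay p q" if "r \<in> P" "p \<in> set (head_vars r)" for r
    using rule_unique[OF assms(1) that(1) assms(2) that(2)] by simp
  have "Static p \<alpha> \<notin> P" "Delay p q' \<in> P \<longleftrightarrow> q' = q" "Dynamic ps A as \<in> P \<Longrightarrow> p \<notin> set ps" for \<alpha> q' ps A as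
    using assms(2) u[of "Static p \<alpha>"] u[of "Delay p q'"] u[of "Dynamic ps A as"] by auto
  moreover have "p \<in> defined_vars P"
    using assms(2) by (force simp: defined_vars_def)
  ultimately show ?thesis
    by (subst sat.simps(6)) (simp only: assms no_Dynamic_head simp_thms)
qed

lemma sat_Dynamic:
  assumes P: "program P" and r: "Dynamic ps A as \<in> P" and i: "i \<in> {1..length ps}"
  shows "sat P I t (Var (ps ! (i - 1))) \<longleftrightarrow>
    (if t = 0 then op_start A = i
     else \<exists>j \<sigma>. j \<in> {1..length ps} \<and> length \<sigma> = length as \<and> op_step A j \<sigma> = i \<and>
       sat P I (t - 1) (Var (ps ! (j - 1))) \<and> sat P I t (assignment_form as \<sigma>))"
proof -
  let ?p = "ps ! (i - 1)"
  have p: "?p \<in> set ps"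
    using i by auto
  have u: "s = Dynamic ps A as" if "s \<in> P" "?p \<in> set (head_vars s)" for s
    using rule_unique[OF P that(1) r that(2)] p by simp
  have D: "?p \<in> defined_vars P"
    using r p by (force simp: defined_vars_def)
  have S: "Static ?p \<alpha> \<notin> P" for \<alpha>
    using u[of "Static ?p \<alpha>"] by auto
  have L: "Delay ?p q \<notin> P" for q
    using u[of "Delay ?p q"] by auto
  \<comment> \<open>The variable must determine not only the rule but also its position in
    \<open>ps\<close>, because that position is the state \<open>i\<close>.\<close>
  have "distinct ps"
    using P r by (force simp: program_def definitorial_def)
  then have "Dynamic ps' A' as' \<in> P \<and> i' \<in> {1..length ps'} \<and> ?p = ps' ! (i' - 1) \<longleftrightarrow>
      ps' = ps \<and> A' = A \<and> as' = as \<and> i' = i" for ps' A' as' i'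
    using u[of "Dynamic ps' A' as'"] r i by (auto simp: nth_eq_iff_index_eq)
  then have "(\<exists>ps' A' as' i'. Dynamic ps' A' as' \<in> P \<and> i' \<in> {1..length ps'} \<and>
      ?p = ps' ! (i' - 1) \<and> X ps' A' as' i') \<longleftrightarrow> X ps A as i" for X
    by metis
  then show ?thesis
    by (subst sat.simps(6)) (simp only: P D S L simp_thms)
qed

section \<open>Dynamic rules follow the run of their operator automaton\<close>

text \<open>A conjunction with one literal per variable fixes all truth values, so exactly one
  \<sigma> is satisfied at each time point. Equal lengths matter because \<open>map2\<close>
  truncates.\<close>

lemma sat_assignment_form:
  assumes "length \<sigma> = length as"
  shows "sat P I t (assignment_form as \<sigma>) \<longleftrightarrow> map (\<lambda>a. sat P I t (Var a)) as = \<sigma>"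
  using assms
proof (induction as arbitrary: \<sigma>)
  case (Cons a as)
  then obtain b \<tau> where \<sigma>: "\<sigma> = b # \<tau>" "length \<tau> = length as"
    by (cases \<sigma>) auto
  have "assignment_form (a # as) \<sigma> = And (literal a b) (assignment_form as \<tau>)"
    by (simp add: assignment_form_def \<sigma>)
  with Cons.IH[OF \<sigma>(2)] show ?case
    by (cases b) (auto simp: \<sigma>(1))
qed (simp add: assignment_form_def)

lemma foldl_op_step_in:
  assumes "wf_op_automaton A" "\<forall>\<sigma> \<in> set w. length \<sigma> = in_arity A"
  shows "foldl (op_step A) (op_start A) w \<in> {1..out_arity A}"
  using assms(2)
  by (induction w rule: rev_induct) (use assms(1) in \<open>auto simp: wf_op_automaton_def\<close>)

text \<open>Induction on \<open>t\<close>: exactly one head variable holds at the previous time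
  point and exactly one \<sigma> holds now, so the existential over \<open>j\<close> and \<sigma>
  describes one deterministic step. At time 0 the word is empty and the state is
  \<open>op_start A\<close>.\<close>

lemma sat_Dynamic_run:
  assumes P: "program P" and r: "Dynamic ps A as \<in> P" and i: "i \<in> {1..length ps}"
  shows "sat P I t (Var (ps ! (i - 1))) \<longleftrightarrow>
    foldl (op_step A) (op_start A) (map (\<lambda>s. map (\<lambda>a. sat P I s (Var a)) as) [1..<Suc t]) = i"
  using i
proof (induction t arbitrary: i)
  case 0
  then show ?case
    by (subst sat_Dynamic[OF P r]) auto
next
  case (Suc t)
  let ?w = "map (\<lambda>s. map (\<lambda>a. sat P I s (Var a)) as) [1..<Suc t]"
  let ?q = "foldl (op_step A) (op_start A) ?w"
  have "wf_rule (Dynamic ps A as)"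
    using P r by (auto simp: program_def)
  then have A: "wf_op_automaton A" "length ps = out_arity A" "length as = in_arity A"
    by auto
  \<comment> \<open>The state reached has to be an admissible witness for \<open>j\<close>
    below.\<close>
  have q: "?q \<in> {1..length ps}"
    unfolding A(2) by (rule foldl_op_step_in[OF A(1)]) (auto simp: A(3))
  have "sat P I (Suc t) (Var (ps ! (i - 1))) \<longleftrightarrow>
    (\<exists>j \<sigma>. j \<in> {1..length ps} \<and> length \<sigma> = length as \<and> op_step A j \<sigma> = i \<and>
       sat P I t (Var (ps ! (j - 1))) \<and> sat P I (Suc t) (assignment_form as \<sigma>))"
    by (subst sat_Dynamic[OF P r Suc.prems]) simp
  also have "\<dots> \<longleftrightarrow> (\<exists>j \<sigma>. j \<in> {1..length ps} \<and> length \<sigma> = length as \<and> op_step A j \<sigma> = i \<and>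
       ?q = j \<and> map (\<lambda>a. sat P I (Suc t) (Var a)) as = \<sigma>)"
    using Suc.IH sat_assignment_form by blast
  also have "\<dots> \<longleftrightarrow> op_step A ?q (map (\<lambda>a. sat P I (Suc t) (Var a)) as) = i"
    using q by auto
  finally show ?case
    by simp
qed

section \<open>Disjunctions, numbering of states, fresh variables\<close>

definition Disj :: "'v form list \<Rightarrow> 'v form" where
  "Disj \<alpha>s = foldr Or \<alpha>s Bot"

lemma sat_Disj [simp]: "sat P I t (Disj \<alpha>s) \<longleftrightarrow> (\<exists>\<alpha> \<in> set \<alpha>s. sat P I t \<alpha>)"
  by (induction \<alpha>s) (auto simp: Disj_def)

lemma vars_Disj [simp]: "vars_form (Disj \<alpha>s) = (\<Union>\<alpha> \<in> set \<alpha>s. vars_form \<alpha>)"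
  by (induction \<alpha>s) (auto simp: Disj_def)

lemma state_after_in:
  assumes "wf_automaton A" "set w \<subseteq> letters A"
  shows "state_after A w \<in> states A"
  using assms(2) unfolding state_after_def
  by (induction w rule: rev_induct) (use assms(1) in \<open>auto simp: wf_automaton_def\<close>)

text \<open>\<open>g\<close> encodes states as numbers and \<open>h\<close> decodes them. Decoding
  is only assumed correct on \<open>states A\<close>, which the run never leaves.\<close>

lemma foldl_op_step_numbering:
  assumes "wf_automaton A" "set w \<subseteq> letters A"
    and "\<And>q. q \<in> states A \<Longrightarrow> h (g q) = q"
    and "op_start M = g (start A)" "\<And>j \<sigma>. op_step M j \<sigma> = g (step A (h j) \<sigma>)"
  shows "foldl (op_step M) (op_start M) w = g (state_after A w)"
  using assms(2)
proof (induction w rule: rev_induct)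
  case (snoc x w)
  then show ?case
    using state_after_in[OF assms(1), of w] assms(3,5) by (simp add: state_after_def)
qed (simp add: state_after_def assms(4))

text \<open>An injective sequence outside \<open>V\<close> is split into its even and its odd
  terms.\<close>

lemma ex_disjoint_fresh_families:
  fixes V :: "'v::infinite set"
  assumes "finite V"
  obtains p d :: "nat \<Rightarrow> 'v" where "inj p" "inj d" "\<And>i j. p i \<noteq> d j"
    "\<And>i. p i \<notin> V" "\<And>i. d i \<notin> V"
proof -
  have "infinite (- V)"
    using assms by (simp add: Compl_eq_Diff_UNIV infinite_UNIV)
  then obtain f :: "nat \<Rightarrow> 'v" where f: "inj f" "range f \<subseteq> - V"
    using infinite_countable_subset by blast
  then have "f i \<notin> V" for i
    by auto
  moreover have "2 * i \<noteq> Suc (2 * j)" for i j :: nat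
    by presburger
  ultimately show thesis
    using f(1) by (intro that[of "\<lambda>i. f (2 * i)" "\<lambda>i. f (Suc (2 * i))"])
      (auto simp: inj_eq intro!: injI)
qed

section \<open>The program of an automaton on assignments\<close>

lemma automaton_on_assignments_program:
  fixes A :: "(bool list, 'q, bool list) automaton" and ins outs :: "'v::infinite list"
  assumes "automaton_on_assignments A ins outs"
  obtains P :: "'v rule set" where "program P" "set ins \<subseteq> input_vars P" "set outs \<subseteq> program_vars P"
    "\<And>I t b. t \<in> {1..length I} \<Longrightarrow> b \<in> set outs \<Longrightarrow> derives A ins outs I t b \<longleftrightarrow> sat P I t (Var b)"
proof -
  have A: "wf_automaton A" and dist: "distinct ins" "distinct outs" "set ins \<inter> set outs = {}"
    and letters: "letters A = {w. length w = length ins}"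
    using assms by (auto simp: automaton_on_assignments_def)
  define n where "n = card (states A)"
  have "finite (states A)"
    using A by (simp add: wf_automaton_def)
  then obtain h where h: "bij_betw h {1..n} (states A)"
    using ex_bij_betw_nat_finite_1 n_def by blast
  define g where "g = the_inv_into {1..n} h"
  have hg: "h (g q) = q" and g_in: "g q \<in> {1..n}" if "q \<in> states A" for q
    using h that f_the_inv_into_f_bij_betw[OF h] bij_betw_the_inv_into[OF h]
    by (auto simp: g_def bij_betw_def)
  have h_in: "h j \<in> states A" if "j \<in> {1..n}" for j
    using h that by (auto simp: bij_betw_def)
  define M where "M = Op_Automaton (length ins) n (\<lambda>j \<sigma>. g (step A (h j) \<sigma>)) (g (start A))"
  obtain p d :: "nat \<Rightarrow> 'v" where fresh: "inj p" "inj d" "\<And>i j. p i \<noteq> d j"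
    "\<And>i. p i \<notin> set ins \<union> set outs" "\<And>i. d i \<notin> set ins \<union> set outs"
    by (rule ex_disjoint_fresh_families[of "set ins \<union> set outs"]) auto
  have disj [simp]: "p i \<noteq> d j" "d j \<noteq> p i" "p i \<notin> set ins" "p i \<notin> set outs" "d i \<notin> set ins"
    "d i \<notin> set outs" for i j
    using fresh(3)[of i j] fresh(4,5)[of i] by auto
  have outs_disj: "p i \<noteq> outs ! k" "d i \<noteq> outs ! k" if "k < length outs" for i k
    using that disj(4,6) nth_mem by metis+
  define ps where "ps = map p [1..<Suc n]"
  \<comment> \<open>\<open>List.n_lists\<close> enumerates all letters. The test of output bit
    \<open>k\<close> decides which disjuncts are built; it is not part of the formula.\<close>
  define \<beta> where "\<beta> k = Disj [And (Var (d j)) (assignment_form ins \<sigma>).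
    j \<leftarrow> [1..<Suc n], \<sigma> \<leftarrow> List.n_lists (length ins) [False, True], emit A (h j) \<sigma> ! k]" for k
  define P where "P = insert (Dynamic ps M ins)
    ((\<lambda>i. Delay (d i) (p i)) ` {1..n} \<union> (\<lambda>k. Static (outs ! k) (\<beta> k)) ` {..<length outs})"
  have ps: "length ps = n" "set ps = p ` {1..n}" "\<And>i. i \<in> {1..n} \<Longrightarrow> ps ! (i - 1) = p i"
    by (auto simp: ps_def nth_append simp del: upt_Suc)
  have defined: "defined_vars P = p ` {1..n} \<union> d ` {1..n} \<union> set outs"
    by (auto simp: defined_vars_def P_def ps in_set_conv_nth)
  have vars_\<beta>: "vars_form (\<beta> k) \<subseteq> d ` {1..n} \<union> set ins" for k
    using vars_assignment_form[of ins] by (fastforce simp: \<beta>_def split: if_splits)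

  \<comment> \<open>Levels of the dependency graph: inputs, \<open>p\<close>, \<open>d\<close>,
    outputs. Every edge goes up, since the body of the dynamic rule consists of \<open>ins\<close>
    alone.\<close>
  define rank :: "'v \<Rightarrow> nat" where "rank x =
    (if x \<in> set outs then 3 else if x \<in> range d then 2 else if x \<in> range p then 1 else 0)" for x
  have rank: "x \<in> set ins \<Longrightarrow> rank x = 0" "rank (p i) = 1" "rank (d i) = 2"
    "x \<in> set outs \<Longrightarrow> rank x = 3" for x i
    using dist(3) by (auto simp: rank_def)
  have "rank a < rank b" if "r \<in> P" "a \<in> body_vars r" "b \<in> set (head_vars r)" for r a b
    using that vars_\<beta> by (fastforce simp: P_def ps rank)
  then have "dep P \<subseteq> measure rank"
    by (auto simp: dep_def)
  then have "nonrecursive P"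
    unfolding nonrecursive_def by (intro wf_acyclic wf_subset[OF wf_measure])
  moreover have "definitorial P"
  proof -
    have "distinct ps"
      using fresh(1) by (simp add: ps_def distinct_map inj_on_def inj_def)
    moreover have "set (head_vars r) \<inter> set (head_vars s) = {}" if "r \<in> P" "s \<in> P" "r \<noteq> s" for r s
      using that fresh(1,2) dist
      by (auto simp: P_def ps outs_disj outs_disj[symmetric] inj_eq nth_eq_iff_index_eq disjoint_iff)
    ultimately show ?thesis
      by (auto simp: definitorial_def P_def)
  qed
  moreover have "wf_op_automaton M"
    using A g_in h_in by (auto simp: M_def wf_op_automaton_def wf_automaton_def letters)
  ultimately have P: "program P"
    by (auto simp: program_def P_def M_def ps)
  have undefined: "a \<notin> defined_vars P" if "a \<in> set ins" for a
    using that dist(3) by (auto simp: defined)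
  show thesis
  proof (rule that[OF P])
    have "set ins \<subseteq> program_vars P"
      by (auto simp: program_vars_def P_def)
    then show "set ins \<subseteq> input_vars P"
      using undefined by (auto simp: input_vars_def)
    show "set outs \<subseteq> program_vars P"
      using defined by (auto simp: defined_vars_def program_vars_def)
  next
    fix I :: "'v set list" and t b
    assume t: "t \<in> {1..length I}" and "b \<in> set outs"
    then obtain k where k: "k < length outs" "b = outs ! k"
      by (metis in_set_conv_nth)
    let ?w = "assignment_string ins I"
    have input: "map (\<lambda>a. sat P I s (Var a)) ins = ?w ! (s - 1)" if "s \<in> {1..length I}" for s
      using that by (auto simp: sat_input[OF P undefined] assignment_string_def)
    \<comment> \<open>Time point \<open>s\<close> reads the letter at index \<open>s - 1\<close>, so
      the time points before \<open>t\<close> yield the first \<open>t - 1\<close> letters.\<close>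
    have inputs: "map (\<lambda>s. map (\<lambda>a. sat P I s (Var a)) ins) [1..<Suc (t - 1)] = take (t - 1) ?w"
      using t by (intro nth_equalityI)
        (auto simp: sat_input[OF P undefined] assignment_string_def simp del: upt_Suc)
    have w: "length x = length ins" if "x \<in> set ?w" for x
      using that by (auto simp: assignment_string_def)
    then have prefix: "set (take (t - 1) ?w) \<subseteq> letters A"
      by (auto simp: letters dest: in_set_takeD)
    let ?q = "state_after A (take (t - 1) ?w)"
    have q: "?q \<in> states A"
      by (rule state_after_in[OF A prefix])
    have run: "foldl (op_step M) (op_start M) (take (t - 1) ?w) = g ?q"
      by (rule foldl_op_step_numbering[OF A prefix, of h]) (simp_all add: hg M_def)
    have r: "Dynamic ps M ins \<in> P"
      by (simp add: P_def)
    have state: "sat P I (t - 1) (Var (p j)) \<longleftrightarrow> g ?q = j" if "j \<in> {1..n}" for j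
      using sat_Dynamic_run[OF P r, of j I "t - 1"] that
      unfolding ps(1) ps(3)[OF that] inputs run by simp
    \<comment> \<open>As \<open>t\<close> is positive, the default value false of a delayed variable
      at time 0 does not arise.\<close>
    have delay: "sat P I t (Var (d j)) \<longleftrightarrow> g ?q = j" if "j \<in> {1..n}" for j
      using sat_Delay[OF P, of "d j" "p j" I t] that t state by (auto simp: P_def)
    have form: "sat P I t (assignment_form ins \<sigma>) \<longleftrightarrow> ?w ! (t - 1) = \<sigma>"
      if "length \<sigma> = length ins" for \<sigma>
      using sat_assignment_form[OF that] input[OF t] by simp
    have wt: "length (?w ! (t - 1)) = length ins"
      using t w[of "?w ! (t - 1)"] by (auto simp: assignment_string_def)
    have "sat P I t (Var b) \<longleftrightarrow> sat P I t (\<beta> k)"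
      using k by (intro sat_Static[OF P]) (auto simp: P_def)
    also have "\<dots> \<longleftrightarrow> (\<exists>j \<in> {1..n}. \<exists>\<sigma>. length \<sigma> = length ins \<and> emit A (h j) \<sigma> ! k \<and>
        sat P I t (Var (d j)) \<and> sat P I t (assignment_form ins \<sigma>))"
    proof -
      \<comment> \<open>\<open>set_n_lists\<close> also asks that entries come from the given list,
        which is automatic for Booleans; only the length condition remains.\<close>
      have "set \<sigma> \<subseteq> {False, True}" for \<sigma> :: "bool list"
        by auto
      then show ?thesis
        by (fastforce simp: \<beta>_def set_n_lists simp del: upt_Suc)
    qed
    also have "\<dots> \<longleftrightarrow> (\<exists>j \<in> {1..n}. \<exists>\<sigma>. length \<sigma> = length ins \<and> emit A (h j) \<sigma> ! k \<and>
        g ?q = j \<and> ?w ! (t - 1) = \<sigma>)"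
      using delay form by blast
    \<comment> \<open>The only candidates are \<open>g ?q\<close> and the current letter; both lie
      in range, and \<open>h\<close> turns \<open>g ?q\<close> back into \<open>?q\<close>.\<close>
    also have "\<dots> \<longleftrightarrow> emit A ?q (?w ! (t - 1)) ! k"
      using g_in[OF q] hg[OF q] wt by auto
    \<comment> \<open>Distinctness of \<open>outs\<close> forces the index in \<open>derives\<close>
      to be \<open>k\<close>.\<close>
    also have "\<dots> \<longleftrightarrow> derives A ins outs I t b"
      using k dist(2) by (auto simp: derives_def output_at_def nth_eq_iff_index_eq)
    finally show "derives A ins outs I t b \<longleftrightarrow> sat P I t (Var b)" ..
  qed
qed

theorem theorem4:
  fixes S :: "bool list set"
    and As :: "(bool list \<times> 'g list, 'q, 'g) automaton list"
    and B :: "(bool list \<times> 'g list, 'q, bool list) automaton"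
    and C :: "(bool list, 'q list, bool list) automaton"
    and ins outs :: "'v::infinite list"
  assumes "is_cascade S As B"
    and "C = cascade S As B"
    and "automaton_on_assignments C ins outs"
  shows "\<exists>P :: 'v rule set. program P \<and>
           set ins \<subseteq> input_vars P \<and> set outs \<subseteq> program_vars P \<and>
           (\<forall>I. interp_over (set ins) I \<longrightarrow>
             (\<forall>t \<in> {1..length I}. \<forall>a \<in> set outs.
               derives C ins outs I t a \<longleftrightarrow> sat P I t (Var a)))"
  by (rule automaton_on_assignments_program[OF assms(3)]) blast

end
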